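(* The admissible state set $\mathcal G$ (equivalently $\mathcal G_0$) is equal to the set $$\mathcal G_1=\Big\{\mathbf U=(D,\mathbf m,\mathbf B,E)^\top\in\mathbb R^8\ \Big|\ D>0,\ \ \mathbf U\cdot\mathbf n^*+p_m^*>0\ \text{ for all } \mathbf B^*,\mathbf v^*\in\mathbb R^3\text{ with }|\mathbf v^*|<1\Big\},$$ where $$\mathbf n^*=\Big(-\sqrt{1-|\mathbf v^*|^2},\ -\mathbf v^*,\ -(1-|\mathbf v^*|^2)\mathbf B^*-(\mathbf v^*\cdot\mathbf B^* )\mathbf v^*,\ 1\Big)^\top,\qquad p_m^*=\frac{(1-|\mathbf v^*|^2)|\mathbf B^*|^2+(\mathbf v^*\cdot\mathbf B^* )^2}{2}.$$
   Context: Fix the adiabatic index $\Gamma\in(1,2]$ (equation of state $p=(\Gamma-1)\rho e$; speed of light $c=1$). For primitive variables $\mathbf V=(\rho,\mathbf v,\mathbf B,p)$ with $\rho,p>0$, $\mathbf v,\mathbf B\in\mathbb R^3$, $|\mathbf v|<1$, put $W=(1-|\mathbf v|^2)^{-1/2}$, $e=\frac{p}{(\Gamma-1)\rho}$, $h=1+e+\frac p\rho$, $p_m=\frac12\big(W^{-2}|\mathbf B|^2+(\mathbf v\cdot\mathbf B)^2\big)$, $p_{tot}=p+p_m$. The associated conservative vector is $\mathbf U(\mathbf V)=(D,\mathbf m,\mathbf B,E)^\top\in\mathbb R^8$ with $D=\rho W$, $\mathbf m=\rho hW^2\mathbf v+|\mathbf B|^2\mathbf v-(\mathbf v\cdot\mathbf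 B)\mathbf B$, $E=\rho hW^2-p_{tot}+|\mathbf B|^2$. The admissible state set is $\mathcal G=\{\mathbf U(\mathbf V): \rho>0,\ p>0,\ |\mathbf v|<1,\ \mathbf B\in\mathbb R^3\}$, i.e. the set of $\mathbf U\in\mathbb R^8$ whose primitive variables satisfy $\rho(\mathbf U)>0$, $p(\mathbf U)>0$, $|\mathbf v(\mathbf U)|<1$. Moreover $\mathcal G_0=\{\mathbf U\in\mathbb R^8: D>0,\ q(\mathbf U)>0,\ \Psi(\mathbf U)>0\}$, where $q(\mathbf U)=E-\sqrt{D^2+|\mathbf m|^2}$, $\Phi(\mathbf U)=\sqrt{(|\mathbf B|^2-E)^2+3(E^2-D^2-|\mathbf m|^2)}$ and $\Psi(\mathbf U)=\big(\Phi(\mathbf U)-2(|\mathbf B|^2-E)\big)\sqrt{\Phi(\mathbf U)+|\mathbf B|^2-E}-\sqrt{\frac{27}{2}(D^2|\mathbf B|^2+(\mathbf m\cdot\mathbf B)^2)}$. *)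

theory Defs
  imports "HOL-Analysis.Analysis"
begin

text \<open>
  Conservative vectors (D, m, B, E) are elements of the product of Euclidean spaces below,
  which is itself a Euclidean space of dimension 8: its inner product is the sum of the
  inner products of the four components, i.e. the standard one of R^8.
\<close>

type_synonym vec3 = "real ^ 3"
type_synonym state = "real \<times> vec3 \<times> vec3 \<times> real"

definition lorentz :: "vec3 \<Rightarrow> real" where
  "lorentz v = 1 / sqrt (1 - (norm v)\<^sup>2)"

definition internal_energy :: "real \<Rightarrow> real \<Rightarrow> real \<Rightarrow> real" where
  "internal_energy \<Gamma> \<rho> p = p / ((\<Gamma> - 1) * \<rho>)"

definition enthalpy :: "real \<Rightarrow> real \<Rightarrow> real \<Rightarrow> real" where
  "enthalpy \<Gamma> \<rho> p = 1 + internal_energy \<Gamma> \<rho> p + p / \<rho>"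

definition mag_pressure :: "vec3 \<Rightarrow> vec3 \<Rightarrow> real" where
  "mag_pressure v B = ((norm B)\<^sup>2 / (lorentz v)\<^sup>2 + (v \<bullet> B)\<^sup>2) / 2"

definition total_pressure :: "vec3 \<Rightarrow> vec3 \<Rightarrow> real \<Rightarrow> real" where
  "total_pressure v B p = p + mag_pressure v B"

definition conservative :: "real \<Rightarrow> real \<Rightarrow> vec3 \<Rightarrow> vec3 \<Rightarrow> real \<Rightarrow> state" where
  "conservative \<Gamma> \<rho> v B p =
    (\<rho> * lorentz v,
     (\<rho> * enthalpy \<Gamma> \<rho> p * (lorentz v)\<^sup>2) *\<^sub>R v + (norm B)\<^sup>2 *\<^sub>R v - (v \<bullet> B) *\<^sub>R B,
     B,
     \<rho> * enthalpy \<Gamma> \<rho> p * (lorentz v)\<^sup>2 - total_pressure v B p + (norm B)\<^sup>2)"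

definition admissible :: "real \<Rightarrow> state set" where
  "admissible \<Gamma> = {conservative \<Gamma> \<rho> v B p | \<rho> v B p. \<rho> > 0 \<and> p > 0 \<and> norm v < 1}"

definition q_fun :: "state \<Rightarrow> real" where
  "q_fun U = (case U of (D, m, B, E) \<Rightarrow> E - sqrt (D\<^sup>2 + (norm m)\<^sup>2))"

text \<open>
  HOL's square root is total, with sqrt (- x) = - sqrt x. This has no effect on the set
  admissible0: there q > 0 gives E^2 > D^2 + |m|^2, so that the radicand of Phi is positive
  and Phi > | |B|^2 - E |.
\<close>

definition Phi_fun :: "state \<Rightarrow> real" where
  "Phi_fun U = (case U of (D, m, B, E) \<Rightarrow>
    sqrt (((norm B)\<^sup>2 - E)\<^sup>2 + 3 * (E\<^sup>2 - D\<^sup>2 - (norm m)\<^sup>2)))"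

definition Psi_fun :: "state \<Rightarrow> real" where
  "Psi_fun U = (case U of (D, m, B, E) \<Rightarrow>
    (Phi_fun U - 2 * ((norm B)\<^sup>2 - E)) * sqrt (Phi_fun U + (norm B)\<^sup>2 - E)
      - sqrt (27 / 2 * (D\<^sup>2 * (norm B)\<^sup>2 + (m \<bullet> B)\<^sup>2)))"

definition admissible0 :: "state set" where
  "admissible0 = {U. fst U > 0 \<and> q_fun U > 0 \<and> Psi_fun U > 0}"

definition n_star :: "vec3 \<Rightarrow> vec3 \<Rightarrow> state" where
  "n_star v B =
    (- sqrt (1 - (norm v)\<^sup>2),
     - v,
     - ((1 - (norm v)\<^sup>2) *\<^sub>R B) - (v \<bullet> B) *\<^sub>R v,
     1)"

definition pm_star :: "vec3 \<Rightarrow> vec3 \<Rightarrow> real" where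
  "pm_star v B = ((1 - (norm v)\<^sup>2) * (norm B)\<^sup>2 + (v \<bullet> B)\<^sup>2) / 2"

definition admissible1 :: "state set" where
  "admissible1 = {U. fst U > 0 \<and>
     (\<forall>Bs vs. norm vs < 1 \<longrightarrow> U \<bullet> n_star vs Bs + pm_star vs Bs > 0)}"

end

theory Submission
  imports Defs
begin

text \<open>
  Fix \<open>D > 0\<close>, \<open>m\<close> and \<open>B\<close>, and write \<open>b = |B|^2\<close>. Everything is compared with one state, the
  \<^emph>\<open>cold\<close> one: the state of zero pressure with these values of \<open>D\<close>, \<open>m\<close>, \<open>B\<close>. Raising the energy
  from its cold value raises the pressure from zero, so admissibility should mean that \<open>E\<close>
  exceeds the energy of the cold state. The proof makes this precise and recognises the
  same comparison in each of the three sets.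

  The momentum equation determines the velocity as a function \<open>velocity m B x\<close> of the unknown
  \<open>x = \<rho> h W^2\<close>. The pressure vanishes where \<open>x^2 (1 - |v|^2) = D^2\<close>; up to a positive factor this is the
  equation \<open>cold_residual = 0\<close>, whose left side is strictly increasing in \<open>x > 0\<close>, so that there is
  a single cold value \<open>x\<^sub>0\<close>. At \<open>x\<^sub>0\<close> the sign of \<open>cold_cubic\<close> is that of the cold energy minus \<open>E\<close>
  (\<open>cold_energy\<close>), so the comparison reads \<open>cold_cubic < 0\<close> at \<open>x\<^sub>0\<close>.

  \<^item> From the constraints to the comparison (\<open>admissible1_imp_cold\<close>): for a fixed test velocity
    the constraint is a convex quadratic in the test field, with minimum at \<open>B\<close>. The constraint
    for the test field \<open>B\<close> and the cold velocity says exactly that \<open>E\<close> exceeds the cold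
    energy, and the one for the test velocity \<open>m / sqrt (D^2 + |m|^2)\<close> gives \<open>q > 0\<close>.

  \<^item> From the comparison to a physical state (\<open>cold_imp_admissible\<close>): the energy as a function
    of \<open>x\<close> is below \<open>E\<close> at \<open>x\<^sub>0\<close> and reaches \<open>E\<close> further right, where monotonicity of the residual
    keeps the pressure positive and the speed below one.

  \<^item> From a physical state to the constraints (\<open>admissible_imp_admissible1\<close>): the constraint splits
    into rest mass, pressure and magnetic contributions, each settled by a
    Cauchy-Schwarz inequality. The bound \<open>\<Gamma> \<le> 2\<close> enters through the pressure term.

  \<^item> The comparison is the inequality \<open>\<Psi> > 0\<close>, given \<open>q > 0\<close> (\<open>cold_cubic_neg_iff\<close>): the residual is the
    sum of a concave parabola and a positive multiple of the cubic. The larger root of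
    the parabola is \<open>z = (\<Phi> - 2 (b - E)) / 3\<close>, and \<open>\<Psi> > 0\<close> says that \<open>z\<close> and the value of the cubic at
    \<open>z\<close> are positive. The cubic is negative at \<open>x\<^sub>0\<close> iff the parabola is positive there, i.e.
    iff \<open>x\<^sub>0 < z\<close>, iff the residual is positive at \<open>z\<close>, iff the cubic is positive at \<open>z\<close>.
\<close>

section \<open>Recovering the velocity from the enthalpy density\<close>

text \<open>
  The solution \<open>v\<close> of \<open>m = (x + |B|^2) v - (v \<bullet> B) B\<close>, where \<open>x\<close> stands for \<open>\<rho> h W^2\<close>. The inner product of the
  equation with \<open>B\<close> gives \<open>v \<bullet> B = (m \<bullet> B) / x\<close>, after which \<open>v\<close> can be read off.
\<close>

definition velocity :: "vec3 \<Rightarrow> vec3 \<Rightarrow> real \<Rightarrow> vec3" where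
  "velocity m B x = (1 / (x + (norm B)\<^sup>2)) *\<^sub>R (m + ((m \<bullet> B) / x) *\<^sub>R B)"

lemma velocity_inner:
  assumes "x > 0"
  shows "velocity m B x \<bullet> B = (m \<bullet> B) / x"
proof -
  have pos: "x + (norm B)\<^sup>2 > 0"
    using assms by (simp add: add_pos_nonneg)
  have "velocity m B x \<bullet> B = (m \<bullet> B + (m \<bullet> B) / x * (norm B)\<^sup>2) / (x + (norm B)\<^sup>2)"
    by (simp add: velocity_def inner_add_left power2_norm_eq_inner)
  also have "m \<bullet> B + (m \<bullet> B) / x * (norm B)\<^sup>2 = (m \<bullet> B) / x * (x + (norm B)\<^sup>2)"
    using assms by (simp add: field_simps)
  also have "\<dots> / (x + (norm B)\<^sup>2) = (m \<bullet> B) / x"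
    using pos by simp
  finally show ?thesis .
qed

lemma velocity_momentum:
  assumes "x > 0"
  shows "x *\<^sub>R velocity m B x + (norm B)\<^sup>2 *\<^sub>R velocity m B x - (velocity m B x \<bullet> B) *\<^sub>R B = m"
proof -
  have pos: "x + (norm B)\<^sup>2 > 0"
    using assms by (simp add: add_pos_nonneg)
  have "x *\<^sub>R velocity m B x + (norm B)\<^sup>2 *\<^sub>R velocity m B x
      = (x + (norm B)\<^sup>2) *\<^sub>R velocity m B x"
    by (simp add: scaleR_add_left)
  also have "\<dots> = m + ((m \<bullet> B) / x) *\<^sub>R B"
    using pos by (simp add: velocity_def)
  finally show ?thesis
    by (simp add: velocity_inner[OF assms])
qed

lemma continuous_on_velocity: "continuous_on {0<..} (velocity m B)"
proof -
  have "x + (norm B)\<^sup>2 \<noteq> 0" if "x > 0" for x :: real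
    using that add_pos_nonneg[of x "(norm B)\<^sup>2"] by simp
  then show ?thesis
    unfolding velocity_def by (intro continuous_intros) auto
qed

section \<open>The state of zero pressure\<close>

definition mag_invariant :: "real \<Rightarrow> vec3 \<Rightarrow> vec3 \<Rightarrow> real" where
  "mag_invariant D m B = D\<^sup>2 * (norm B)\<^sup>2 + (m \<bullet> B)\<^sup>2"

text \<open>
  With \<open>b = |B|^2\<close>, \<open>S = D^2 + |m|^2\<close> and \<open>c = mag_invariant D m B\<close> this is the condition
  \<open>x^2 (1 - |v|^2) = D^2\<close> of zero pressure, cleared of its positive factor. In this form both
  the monotonicity in \<open>x\<close> and the relation to \<open>\<Phi>\<close> are visible.
\<close>

definition cold_residual :: "real \<Rightarrow> real \<Rightarrow> real \<Rightarrow> real \<Rightarrow> real" where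
  "cold_residual b S c x = (x + b)\<^sup>2 - S - c * (2 * x + b) / x\<^sup>2"

text \<open>
  With \<open>a = |B|^2 - E\<close> and \<open>c = mag_invariant D m B\<close>, this is \<open>x^2\<close> times the defect in the energy equation
  when the pressure is zero, so that \<open>D^2 / x^2\<close> may replace \<open>1 - |v|^2\<close>.
\<close>

definition cold_cubic :: "real \<Rightarrow> real \<Rightarrow> real \<Rightarrow> real" where
  "cold_cubic a c x = x ^ 3 + a * x\<^sup>2 - c / 2"

text \<open>
  The terms in \<open>D\<close> recombine by \<open>D^2 (x + b)^2 - D^2 b (2 x + b) = D^2 x^2\<close>; this is why \<open>mag_invariant\<close> appears.
\<close>

lemma cold_residual_velocity:
  fixes m B :: vec3
  assumes "x > 0"
  defines "b \<equiv> (norm B)\<^sup>2"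
  shows "cold_residual b (D\<^sup>2 + (norm m)\<^sup>2) (mag_invariant D m B) x
    = (x + b)\<^sup>2 / x\<^sup>2 * (x\<^sup>2 * (1 - (norm (velocity m B x))\<^sup>2) - D\<^sup>2)"
proof -
  have pos: "x + b > 0"
    using assms by (simp add: add_pos_nonneg)
  define k where "k = m \<bullet> B"
  have "(norm (m + (k / x) *\<^sub>R B))\<^sup>2 = (norm m)\<^sup>2 + 2 * k * k / x + (k / x)\<^sup>2 * b"
    unfolding power2_norm_eq_inner b_def k_def
    by (simp add: inner_add_left inner_add_right inner_commute power2_eq_square)
  moreover have "norm (velocity m B x) = norm (m + (k / x) *\<^sub>R B) / (x + b)"
    using pos by (simp add: velocity_def b_def k_def)
  ultimately have v: "(norm (velocity m B x))\<^sup>2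
      = ((norm m)\<^sup>2 + 2 * k * k / x + (k / x)\<^sup>2 * b) / (x + b)\<^sup>2"
    by (simp add: power_divide)
  then have v': "(x + b)\<^sup>2 * (norm (velocity m B x))\<^sup>2
      = (norm m)\<^sup>2 + 2 * k * k / x + (k / x)\<^sup>2 * b"
    using pos by simp
  have "(x + b)\<^sup>2 / x\<^sup>2 * (x\<^sup>2 * (1 - (norm (velocity m B x))\<^sup>2) - D\<^sup>2)
      = (x + b)\<^sup>2 - (x + b)\<^sup>2 * (norm (velocity m B x))\<^sup>2 - D\<^sup>2 * (x + b)\<^sup>2 / x\<^sup>2"
    using assms(1) by (simp add: field_simps)
  also have "\<dots> = (x + b)\<^sup>2 - ((norm m)\<^sup>2 + 2 * k * k / x + (k / x)\<^sup>2 * b)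
      - D\<^sup>2 * (x + b)\<^sup>2 / x\<^sup>2"
    by (simp only: v')
  also have "\<dots> = cold_residual b (D\<^sup>2 + (norm m)\<^sup>2) (mag_invariant D m B) x"
    unfolding cold_residual_def mag_invariant_def b_def[symmetric] k_def[symmetric]
    using assms(1) by (simp add: divide_simps) (simp add: algebra_simps power2_eq_square)
  finally show ?thesis by simp
qed

lemma cold_residual_strict_mono:
  assumes "b \<ge> 0" "c \<ge> 0" "0 < x" "x < y"
  shows "cold_residual b S c x < cold_residual b S c y"
proof -
  have "(x + b)\<^sup>2 < (y + b)\<^sup>2"
    using assms by (intro power_strict_mono) auto
  moreover have "c * (2 * y + b) / y\<^sup>2 \<le> c * (2 * x + b) / x\<^sup>2"
  proof -
    have split: "c * (2 * z + b) / z\<^sup>2 = c * (2 / z + b / z\<^sup>2)" if "z > 0" for z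
      using that by (simp add: field_simps power2_eq_square)
    have "2 / y + b / y\<^sup>2 \<le> 2 / x + b / x\<^sup>2"
      using assms by (intro add_mono divide_left_mono power_mono mult_pos_pos zero_less_power) auto
    then show ?thesis
      using assms by (simp add: split mult_left_mono)
  qed
  ultimately show ?thesis
    unfolding cold_residual_def by linarith
qed

text \<open>
  Since \<open>1 - |v|^2 \<le> 1\<close>, the residual cannot be positive at \<open>x = D\<close>, and it grows like \<open>x^2\<close>; the intermediate value
  theorem gives a root.
\<close>

lemma cold_root_exists:
  fixes m B :: vec3
  assumes "D > 0"
  shows "\<exists>x>0. cold_residual ((norm B)\<^sup>2) (D\<^sup>2 + (norm m)\<^sup>2) (mag_invariant D m B) x = 0"
proof -
  define b where "b = (norm B)\<^sup>2"
  define S where "S = D\<^sup>2 + (norm m)\<^sup>2"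
  define c where "c = mag_invariant D m B"
  have b: "b \<ge> 0" and S: "S \<ge> 0" and c: "c \<ge> 0"
    by (simp_all add: b_def S_def c_def mag_invariant_def)
  define y where "y = 1 + D + S + c * (2 + b)"
  have cb: "c * (2 + b) \<ge> 0"
    using b c by simp
  then have y: "y \<ge> 1" "y \<ge> D" "y > S + c * (2 + b)"
    using S assms by (auto simp: y_def)
  have "cold_residual b S c D
      = (D + b)\<^sup>2 / D\<^sup>2 * (D\<^sup>2 * (1 - (norm (velocity m B D))\<^sup>2) - D\<^sup>2)"
    unfolding b_def S_def c_def by (rule cold_residual_velocity[OF assms])
  also have "\<dots> \<le> 0"
    by (intro mult_nonneg_nonpos) (auto simp: algebra_simps)
  finally have low: "cold_residual b S c D \<le> 0" .
  have "c * (2 * y + b) / y\<^sup>2 \<le> c * (2 + b)"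
  proof -
    have "2 * y \<le> 2 * y\<^sup>2"
      using y by (simp add: power2_eq_square)
    moreover have "b \<le> b * y\<^sup>2"
      using b y by (simp add: mult_le_cancel_left1)
    ultimately have "2 * y + b \<le> (2 + b) * y\<^sup>2"
      by (simp add: algebra_simps)
    then have "c * (2 * y + b) \<le> c * (2 + b) * y\<^sup>2"
      using c by (simp add: mult_left_mono mult.assoc)
    then show ?thesis
      using y by (simp add: divide_le_eq)
  qed
  moreover have "y \<le> (y + b)\<^sup>2"
  proof -
    have "y * 1 \<le> (y + b) * (y + b)"
      using y b by (intro mult_mono) auto
    then show ?thesis by (simp add: power2_eq_square)
  qed
  ultimately have high: "0 \<le> cold_residual b S c y"
    using y(3) unfolding cold_residual_def by linarith
  have "continuous_on {D..y} (cold_residual b S c)"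
    unfolding cold_residual_def using assms by (intro continuous_intros) auto
  then obtain x where "D \<le> x" "x \<le> y" "cold_residual b S c x = 0"
    using IVT'[of "cold_residual b S c" D 0 y] low high y(2) by blast
  then show ?thesis
    using assms unfolding b_def S_def c_def by (intro exI[of _ x]) auto
qed

text \<open>
  A root of the residual carries a genuine state of zero pressure. Its energy is
  \<open>x + |B|^2 - pm_star v B\<close>, and \<open>cold_cubic\<close> measures the distance to \<open>E\<close>.
\<close>

lemma cold_energy:
  fixes m B :: vec3
  assumes x: "x > 0" and D: "D > 0"
    and root: "cold_residual ((norm B)\<^sup>2) (D\<^sup>2 + (norm m)\<^sup>2) (mag_invariant D m B) x = 0"
  defines "v \<equiv> velocity m B x"
  shows "norm v < 1" and "D = x * sqrt (1 - (norm v)\<^sup>2)"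
    and "cold_cubic ((norm B)\<^sup>2 - E) (mag_invariant D m B) x
      = x\<^sup>2 * (x + (norm B)\<^sup>2 - pm_star v B - E)"
proof -
  have "x + (norm B)\<^sup>2 \<noteq> 0"
    using x by (simp add: add_pos_nonneg less_imp_neq[symmetric])
  then have eq: "x\<^sup>2 * (1 - (norm v)\<^sup>2) = D\<^sup>2"
    using cold_residual_velocity[OF x, of B D m] root x unfolding v_def by simp
  moreover have "D\<^sup>2 > 0" using D by simp
  ultimately have pos: "1 - (norm v)\<^sup>2 > 0"
    by (metis x zero_less_mult_pos zero_less_power)
  then show "norm v < 1"
    by (simp add: power_less_one_iff abs_square_less_1)
  have "D = sqrt (D\<^sup>2)" using D by simp
  also have "\<dots> = x * sqrt (1 - (norm v)\<^sup>2)"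
    using x by (simp add: eq[symmetric] real_sqrt_mult)
  finally show "D = x * sqrt (1 - (norm v)\<^sup>2)" .
  have "v \<bullet> B = (m \<bullet> B) / x"
    unfolding v_def by (rule velocity_inner[OF x])
  then have "x * (v \<bullet> B) = m \<bullet> B" using x by simp
  then have "mag_invariant D m B = x\<^sup>2 * (2 * pm_star v B)"
    by (simp add: mag_invariant_def pm_star_def eq[symmetric] power_mult_distrib
        algebra_simps flip: \<open>x * (v \<bullet> B) = m \<bullet> B\<close>)
  then show "cold_cubic ((norm B)\<^sup>2 - E) (mag_invariant D m B) x
      = x\<^sup>2 * (x + (norm B)\<^sup>2 - pm_star v B - E)"
    by (simp add: cold_cubic_def algebra_simps power2_eq_square power3_eq_cube)
qed

section \<open>The explicit condition in terms of \<Phi> and \<Psi>\<close>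

text \<open>
  Division of the residual by the cubic: substituting \<open>c = 2 x^2 (x + b - E) - 2 cold_cubic\<close> leaves a concave
  parabola, whose discriminant is a multiple of the square of \<open>\<Phi>\<close>.
\<close>

lemma cold_residual_cubic:
  assumes "x > 0"
  shows "cold_residual b S c x
    = (E\<^sup>2 - S - (3 * x\<^sup>2 + 4 * (b - E) * x + (b - E)\<^sup>2))
      + 2 * (2 * x + b) / x\<^sup>2 * cold_cubic (b - E) c x"
  using assms unfolding cold_residual_def cold_cubic_def
  by (simp add: divide_simps) (simp add: algebra_simps power2_eq_square power3_eq_cube)

text \<open>
  At a root of the residual the parabola and the cubic have opposite signs, so the cubic is
  negative there iff \<open>x\<close> lies between the roots of the parabola. The smaller root lies below
  \<open>-a\<close>, and a nonnegative value of the cubic forces \<open>x \<ge> -a\<close>, hence only the larger root \<open>z\<close>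
  matters. At \<open>z\<close> the parabola vanishes, and the residual and the cubic have the same sign.
\<close>

lemma cold_cubic_neg_iff:
  fixes b c S E :: real
  assumes b: "b \<ge> 0" and c: "c \<ge> 0" and q: "S < E\<^sup>2" 
    and x: "x > 0" and root: "cold_residual b S c x = 0"
  defines "a \<equiv> b - E"
  defines "F \<equiv> sqrt (a\<^sup>2 + 3 * (E\<^sup>2 - S))"
  shows "cold_cubic a c x < 0 \<longleftrightarrow> (F - 2 * a) * sqrt (F + a) - sqrt (27 / 2 * c) > 0"
proof -
  have rad: "a\<^sup>2 + 3 * (E\<^sup>2 - S) > a\<^sup>2"
    using q by simp
  then have F2: "F\<^sup>2 = a\<^sup>2 + 3 * (E\<^sup>2 - S)"
    unfolding F_def by (metis dual_order.strict_implies_order order_trans real_sqrt_pow2 zero_le_power2)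
  have "sqrt (a\<^sup>2) < F"
    unfolding F_def using rad real_sqrt_less_iff by blast
  then have Fa: "\<bar>a\<bar> < F" by simp
  \<comment> \<open>The roots of the parabola are \<open>z\<close> and \<open>- (2 * a + F) / 3\<close>.\<close>
  define z where "z = (F - 2 * a) / 3"
  have parabola: "E\<^sup>2 - S - (3 * y\<^sup>2 + 4 * a * y + a\<^sup>2) = 3 * (z - y) * (y + (2 * a + F) / 3)" for y
  proof -
    have "E\<^sup>2 - S = (F\<^sup>2 - a\<^sup>2) / 3" using F2 by simp
    then show ?thesis
      unfolding z_def by (simp add: field_simps power2_eq_square)
  qed
  have R: "cold_residual b S c y
      = 3 * (z - y) * (y + (2 * a + F) / 3) + 2 * (2 * y + b) / y\<^sup>2 * cold_cubic a c y"
    if "y > 0" for y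
    using cold_residual_cubic[OF that, of b S c E] parabola[of y] by (simp add: a_def)
  have w: "2 * (2 * y + b) / y\<^sup>2 > 0" if "y > 0" for y
    using that b by simp
  \<comment> \<open>\<open>\<Psi> > 0\<close> compares two square roots; squaring turns it into the sign of the cubic at \<open>z\<close>, provided \<open>z > 0\<close>.\<close>
  have z_cubic: "cold_cubic a c z = (F - 2 * a)\<^sup>2 * (F + a) / 27 - c / 2"
    unfolding cold_cubic_def z_def by (simp add: field_simps power2_eq_square power3_eq_cube)
  have Psi: "(F - 2 * a) * sqrt (F + a) - sqrt (27 / 2 * c) > 0
      \<longleftrightarrow> z > 0 \<and> cold_cubic a c z > 0"
  proof (cases "F - 2 * a > 0")
    case True
    then have "(F - 2 * a) * sqrt (F + a) = sqrt ((F - 2 * a)\<^sup>2 * (F + a))"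
      by (simp add: real_sqrt_mult)
    then have "(F - 2 * a) * sqrt (F + a) - sqrt (27 / 2 * c) > 0
        \<longleftrightarrow> 27 / 2 * c < (F - 2 * a)\<^sup>2 * (F + a)"
      by simp
    then show ?thesis
      using True unfolding z_cubic by (auto simp: z_def)
  next
    case False
    then have "(F - 2 * a) * sqrt (F + a) \<le> 0"
      using Fa by (intro mult_nonpos_nonneg) auto
    moreover have "sqrt (27 / 2 * c) \<ge> 0" using c by simp
    ultimately have "\<not> (F - 2 * a) * sqrt (F + a) - sqrt (27 / 2 * c) > 0"
      by linarith
    then show ?thesis
      using False by (simp add: z_def)
  qed
  have "cold_cubic a c x < 0 \<longleftrightarrow> z > 0 \<and> cold_cubic a c z > 0"
  proof
    assume neg: "cold_cubic a c x < 0"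
    then have "3 * (z - x) * (x + (2 * a + F) / 3) > 0"
      using R[OF x] root mult_pos_neg[OF w[OF x] neg] by linarith
    moreover have "z > x" if "3 * (z - x) * (x + (2 * a + F) / 3) > 0"
    proof (rule ccontr)
      assume "\<not> z > x"
      then have "x + (2 * a + F) / 3 < 0"
        using that by (simp add: zero_less_mult_iff)
      then show False
        using \<open>\<not> z > x\<close> x Fa unfolding z_def by argo
    qed
    ultimately have zx: "z > x" by blast
    then have "cold_residual b S c z > 0"
      using cold_residual_strict_mono[OF b c x zx, of S] root by simp
    then have "2 * (2 * z + b) / z\<^sup>2 * cold_cubic a c z > 0"
      using R[of z] zx x by simp
    then have "cold_cubic a c z > 0"
      using w[of z] zx x by (simp only: zero_less_mult_iff) linarith
    then show "z > 0 \<and> cold_cubic a c z > 0"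
      using zx x by simp
  next
    assume z: "z > 0 \<and> cold_cubic a c z > 0"
    then have "cold_residual b S c z = 2 * (2 * z + b) / z\<^sup>2 * cold_cubic a c z"
      using R[of z] by simp
    then have "cold_residual b S c z > 0"
      using z mult_pos_pos[OF w[of z]] by simp
    then have xz: "x < z"
      using cold_residual_strict_mono[OF b c, of z x S] root z
      by (metis less_irrefl linorder_neqE_linordered_idom order_less_trans)
    show "cold_cubic a c x < 0"
    proof (rule ccontr)
      assume "\<not> cold_cubic a c x < 0"
      then have nn: "cold_cubic a c x \<ge> 0" by simp
      have "x\<^sup>2 * (x + a) = cold_cubic a c x + c / 2"
        by (simp add: cold_cubic_def algebra_simps power2_eq_square power3_eq_cube)
      then have "0 \<le> x\<^sup>2 * (x + a)"
        using nn c by simp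
      then have "x + a \<ge> 0"
        using x by (simp add: zero_le_mult_iff)
      then have "x + (2 * a + F) / 3 > 0"
        using Fa by argo
      then have "3 * (z - x) * (x + (2 * a + F) / 3) > 0"
        using xz by simp
      moreover have "2 * (2 * x + b) / x\<^sup>2 * cold_cubic a c x \<ge> 0"
        by (intro mult_nonneg_nonneg less_imp_le[OF w[OF x]] nn)
      ultimately show False
        using R[OF x] root by linarith
    qed
  qed
  then show ?thesis
    using Psi by simp
qed

lemma admissible0_iff_cold:
  fixes m B :: vec3
  assumes x: "x > 0"
    and root: "cold_residual ((norm B)\<^sup>2) (D\<^sup>2 + (norm m)\<^sup>2) (mag_invariant D m B) x = 0"
  shows "(D, m, B, E) \<in> admissible0 \<longleftrightarrow>
    D > 0 \<and> E > sqrt (D\<^sup>2 + (norm m)\<^sup>2)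
      \<and> cold_cubic ((norm B)\<^sup>2 - E) (mag_invariant D m B) x < 0"
proof (cases "E > sqrt (D\<^sup>2 + (norm m)\<^sup>2)")
  case True
  then have q: "D\<^sup>2 + (norm m)\<^sup>2 < E\<^sup>2"
    by (metis real_less_rsqrt real_sqrt_abs real_sqrt_less_iff abs_ge_self less_le_trans)
  have c: "mag_invariant D m B \<ge> 0"
    by (simp add: mag_invariant_def)
  show ?thesis
    using cold_cubic_neg_iff[OF _ c q x root] True
    by (simp add: admissible0_def q_fun_def Psi_fun_def Phi_fun_def mag_invariant_def
        diff_diff_eq add_diff_eq)
next
  case False
  then show ?thesis
    by (simp add: admissible0_def q_fun_def)
qed

section \<open>The linear constraints\<close>

lemma n_star_same_field:
  "(D, m, B, E) \<bullet> n_star v B + pm_star v B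
    = E - D * sqrt (1 - (norm v)\<^sup>2) - m \<bullet> v - pm_star v B"
  by (simp add: n_star_def pm_star_def inner_diff_right dot_square_norm inner_commute
      algebra_simps power2_eq_square)

lemma pm_star_nonneg:
  assumes "norm v < 1"
  shows "pm_star v B \<ge> 0"
proof -
  have "(norm v)\<^sup>2 \<le> 1"
    using assms by (simp add: abs_square_le_1)
  then show ?thesis
    by (simp add: pm_star_def)
qed

text \<open>
  For a fixed velocity the constraint is quadratic in the test field, with second-order part
  \<open>pm_star v\<close>. Completing the square shows that its minimum is attained at the field \<open>B\<close> of the state.
\<close>

lemma n_star_ge_same_field:
  assumes "norm v < 1"
  shows "(D, m, B, E) \<bullet> n_star v B' + pm_star v B' \<ge> (D, m, B, E) \<bullet> n_star v B + pm_star v B"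
proof -
  \<comment> \<open>Hides the norm of \<open>v\<close>, so that the norms of the fields alone become inner products.\<close>
  define k where "k = 1 - (norm v)\<^sup>2"
  have "(D, m, B, E) \<bullet> n_star v B' + pm_star v B'
      = (D, m, B, E) \<bullet> n_star v B + pm_star v B + pm_star v (B' - B)"
    unfolding n_star_def pm_star_def k_def[symmetric] power2_norm_eq_inner[of B]
      power2_norm_eq_inner[of B'] power2_norm_eq_inner[of "B' - B"]
    by (simp add: inner_diff_right inner_diff_left inner_commute algebra_simps
        power2_eq_square add_divide_distrib diff_divide_distrib)
  then show ?thesis
    using pm_star_nonneg[OF assms] by simp
qed

lemma admissible1_iff:
  "(D, m, B, E) \<in> admissible1 \<longleftrightarrow>
    D > 0 \<and> (\<forall>v. norm v < 1 \<longrightarrow> D * sqrt (1 - (norm v)\<^sup>2) + m \<bullet> v + pm_star v B < E)"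
proof -
  have "(\<forall>B' v. norm v < 1 \<longrightarrow> (D, m, B, E) \<bullet> n_star v B' + pm_star v B' > 0) \<longleftrightarrow>
      (\<forall>v. norm v < 1 \<longrightarrow> (D, m, B, E) \<bullet> n_star v B + pm_star v B > 0)"
    by (meson n_star_ge_same_field less_le_trans)
  moreover have "(D, m, B, E) \<bullet> n_star v B + pm_star v B > 0 \<longleftrightarrow>
      D * sqrt (1 - (norm v)\<^sup>2) + m \<bullet> v + pm_star v B < E" for v
    unfolding n_star_same_field by linarith
  ultimately show ?thesis
    unfolding admissible1_def mem_Collect_eq fst_conv by presburger
qed

text \<open>
  Two test velocities suffice. The vector \<open>m / sqrt (D^2 + |m|^2)\<close> maximises \<open>D sqrt (1 - |v|^2) + m \<bullet> v\<close>, with maximal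
  value \<open>sqrt (D^2 + |m|^2)\<close>. For the cold velocity the left side of the constraint is the cold energy.
\<close>

lemma admissible1_imp_cold:
  fixes m B :: vec3
  assumes U: "(D, m, B, E) \<in> admissible1" and x: "x > 0"
    and root: "cold_residual ((norm B)\<^sup>2) (D\<^sup>2 + (norm m)\<^sup>2) (mag_invariant D m B) x = 0"
  shows "E > sqrt (D\<^sup>2 + (norm m)\<^sup>2)"
    and "cold_cubic ((norm B)\<^sup>2 - E) (mag_invariant D m B) x < 0"
proof -
  have D: "D > 0" and bound:
    "\<And>v. norm v < 1 \<Longrightarrow> D * sqrt (1 - (norm v)\<^sup>2) + m \<bullet> v + pm_star v B < E"
    using U by (auto simp: admissible1_iff)
  show "E > sqrt (D\<^sup>2 + (norm m)\<^sup>2)"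
  proof -
    define s where "s = sqrt (D\<^sup>2 + (norm m)\<^sup>2)"
    have s2: "s\<^sup>2 = D\<^sup>2 + (norm m)\<^sup>2" by (simp add: s_def)
    have s: "s > 0" using D by (simp add: s_def add_pos_nonneg)
    define v where "v = (1 / s) *\<^sub>R m"
    have "norm m < s"
      using D unfolding s_def by (intro real_less_rsqrt) simp
    then have v: "norm v < 1"
      using s by (simp add: v_def)
    have "(norm v)\<^sup>2 = (norm m)\<^sup>2 / s\<^sup>2"
      by (simp add: v_def power_divide)
    moreover have "(norm m)\<^sup>2 / s\<^sup>2 + D\<^sup>2 / s\<^sup>2 = 1"
      using s by (simp add: add_divide_distrib[symmetric] s2[symmetric] add.commute)
    ultimately have "1 - (norm v)\<^sup>2 = (D / s)\<^sup>2"
      by (simp add: power_divide)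
    then have "sqrt (1 - (norm v)\<^sup>2) = D / s"
      using s D by simp
    then have "D * sqrt (1 - (norm v)\<^sup>2) = D\<^sup>2 / s"
      by (simp add: power2_eq_square)
    moreover have "m \<bullet> v = (norm m)\<^sup>2 / s"
      by (simp add: v_def power2_norm_eq_inner)
    moreover have "D\<^sup>2 / s + (norm m)\<^sup>2 / s = s"
      using s s2 by (simp add: field_simps power2_eq_square)
    ultimately show ?thesis
      using bound[OF v] pm_star_nonneg[OF v, of B] unfolding s_def by linarith
  qed
  define v where "v = velocity m B x"
  note cold = cold_energy[OF x D root, folded v_def]
  have sq: "(sqrt (1 - (norm v)\<^sup>2))\<^sup>2 = 1 - (norm v)\<^sup>2"
    using cold(1) by (simp add: abs_square_le_1)
  have "D * sqrt (1 - (norm v)\<^sup>2) = x * (sqrt (1 - (norm v)\<^sup>2))\<^sup>2"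
    using cold(2) by (simp add: power2_eq_square)
  then have "D * sqrt (1 - (norm v)\<^sup>2) = x * (1 - (norm v)\<^sup>2)"
    using sq by simp
  moreover have "m \<bullet> v = (x + (norm B)\<^sup>2) * (norm v)\<^sup>2 - (v \<bullet> B)\<^sup>2"
  proof -
    have "m \<bullet> v = (x *\<^sub>R v + (norm B)\<^sup>2 *\<^sub>R v - (v \<bullet> B) *\<^sub>R B) \<bullet> v"
      using velocity_momentum[OF x, of m B] by (simp add: v_def)
    also have "\<dots> = (x + (norm B)\<^sup>2) * (norm v)\<^sup>2 - (v \<bullet> B)\<^sup>2"
      by (simp add: inner_diff_left inner_add_left dot_square_norm inner_commute
          algebra_simps power2_eq_square)
    finally show ?thesis .
  qed
  moreover have "(1 - (norm v)\<^sup>2) * (norm B)\<^sup>2 + (v \<bullet> B)\<^sup>2 = 2 * pm_star v B"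
    by (simp add: pm_star_def)
  ultimately have "x + (norm B)\<^sup>2 - pm_star v B - E < 0"
    using bound[OF cold(1)] by (simp add: algebra_simps)
  then show "cold_cubic ((norm B)\<^sup>2 - E) (mag_invariant D m B) x < 0"
    unfolding cold(3) using x by (simp add: mult_pos_neg)
qed

section \<open>States with positive pressure\<close>

lemma lorentz_power2:
  assumes "norm v < 1"
  shows "(lorentz v)\<^sup>2 = 1 / (1 - (norm v)\<^sup>2)"
  using assms by (simp add: lorentz_def power_divide abs_square_le_1)

lemma mag_pressure_eq_pm_star:
  assumes "norm v < 1"
  shows "mag_pressure v B = pm_star v B"
  by (simp add: mag_pressure_def pm_star_def lorentz_power2[OF assms] mult.commute)

lemma enthalpy_density:
  assumes "\<rho> > 0" "\<Gamma> > 1"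
  shows "\<rho> * enthalpy \<Gamma> \<rho> p = \<rho> + \<Gamma> / (\<Gamma> - 1) * p"
  using assms by (simp add: enthalpy_def internal_energy_def field_simps)

text \<open>
  Eliminating \<open>\<rho>\<close> from \<open>x = \<rho> h W^2\<close> and \<open>D = \<rho> W\<close> gives the pressure \<open>p\<close> as a function of \<open>x\<close>, which leaves the single energy
  equation \<open>H x = E\<close>. To the right of the cold root the residual is positive; this yields
  both \<open>|v| < 1\<close> and \<open>p > 0\<close>. At the root \<open>H < E\<close> by hypothesis, and \<open>H\<close> grows at least like \<open>x / \<Gamma>\<close>.
\<close>

lemma cold_imp_admissible:
  fixes m B :: vec3
  assumes \<Gamma>: "1 < \<Gamma>" and D: "D > 0" and x: "x > 0"
    and root: "cold_residual ((norm B)\<^sup>2) (D\<^sup>2 + (norm m)\<^sup>2) (mag_invariant D m B) x = 0"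
    and neg: "cold_cubic ((norm B)\<^sup>2 - E) (mag_invariant D m B) x < 0"
  shows "(D, m, B, E) \<in> admissible \<Gamma>"
proof -
  define s where "s y = 1 - (norm (velocity m B y))\<^sup>2" for y
  define p where "p y = (1 - 1 / \<Gamma>) * (y * s y - D * sqrt (s y))" for y
  define H where "H y = y - p y - pm_star (velocity m B y) B + (norm B)\<^sup>2" for y
  note cold = cold_energy[OF x D root]
  have s_gt: "D\<^sup>2 \<le> y\<^sup>2 * s y" "y > x \<Longrightarrow> D\<^sup>2 < y\<^sup>2 * s y" if "y \<ge> x" for y
  proof -
    have y: "y > 0" using x that by simp
    let ?R = "cold_residual ((norm B)\<^sup>2) (D\<^sup>2 + (norm m)\<^sup>2) (mag_invariant D m B)"
    have c: "mag_invariant D m B \<ge> 0"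
      by (simp add: mag_invariant_def)
    have w: "(y + (norm B)\<^sup>2)\<^sup>2 / y\<^sup>2 > 0"
      using y by (intro divide_pos_pos zero_less_power add_pos_nonneg) auto
    have R: "?R y = (y + (norm B)\<^sup>2)\<^sup>2 / y\<^sup>2 * (y\<^sup>2 * s y - D\<^sup>2)"
      unfolding s_def by (rule cold_residual_velocity[OF y])
    show lt: "D\<^sup>2 < y\<^sup>2 * s y" if "y > x"
    proof -
      have "?R y > 0"
        using cold_residual_strict_mono[OF _ c x that, of "(norm B)\<^sup>2"
            "D\<^sup>2 + (norm m)\<^sup>2"] root by simp
      then have "y\<^sup>2 * s y - D\<^sup>2 > 0"
        unfolding R using w by (rule zero_less_mult_pos)
      then show ?thesis by simp
    qed
    have "y = x \<Longrightarrow> D\<^sup>2 \<le> y\<^sup>2 * s y"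
      using R root w by auto
    then show "D\<^sup>2 \<le> y\<^sup>2 * s y"
      using lt that by force
  qed
  have s_pos: "s y > 0" if "y \<ge> x" for y
  proof -
    have "y\<^sup>2 * s y > 0"
      using s_gt(1)[OF that] zero_less_power[OF D, of 2] by linarith
    then show ?thesis
      using x that by (simp add: zero_less_mult_iff)
  qed
  have v_lt: "norm (velocity m B y) < 1" if "y \<ge> x" for y
    using s_pos[OF that] by (simp add: s_def abs_square_less_1)
  have p_eq: "y * s y - D * sqrt (s y) = sqrt (s y) * (y * sqrt (s y) - D)" if "y \<ge> x" for y
    using s_pos[OF that] by (simp add: algebra_simps)
  have p_pos: "p y > 0" if "y > x" for y
  proof -
    have "D\<^sup>2 < (y * sqrt (s y))\<^sup>2"
      using s_gt(2)[of y] s_pos[of y] that by (simp add: power_mult_distrib)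
    then have "D < y * sqrt (s y)"
      by (rule power_less_imp_less_base) (use x that s_pos[of y] in simp)
    then show ?thesis
      using p_eq[of y] s_pos[of y] that \<Gamma> unfolding p_def by simp
  qed
  have "p x = 0"
    using p_eq[of x] cold(2) unfolding p_def s_def by simp
  then have "x\<^sup>2 * (H x - E) < 0"
    using neg unfolding cold(3) H_def by (simp add: algebra_simps)
  then have low: "H x \<le> E"
    using x by (simp add: mult_less_0_iff)
  \<comment> \<open>The lower bound \<open>x / \<Gamma>\<close> for \<open>H\<close> reaches \<open>E\<close> at \<open>\<Gamma> * E\<close>.\<close>
  define y where "y = max x (\<Gamma> * E)"
  have yx: "y \<ge> x" and yE: "y \<ge> \<Gamma> * E"
    by (simp_all add: y_def)
  have y0: "y > 0" using x yx by simp
  have high: "E \<le> H y"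
  proof -
    let ?v = "velocity m B y"
    have "p y \<le> (1 - 1 / \<Gamma>) * y"
    proof -
      have "y * s y \<le> y" "D * sqrt (s y) \<ge> 0"
        using y0 D s_pos[OF yx] by (auto simp: s_def algebra_simps)
      then show ?thesis
        unfolding p_def using \<Gamma> by (intro mult_left_mono) auto
    qed
    moreover have "pm_star ?v B \<le> (norm B)\<^sup>2"
    proof -
      have "\<bar>?v \<bullet> B\<bar> \<le> norm ?v * norm B"
        by (rule Cauchy_Schwarz_ineq2)
      then have "(?v \<bullet> B)\<^sup>2 \<le> (norm ?v * norm B)\<^sup>2"
        by (metis abs_ge_zero power2_abs power_mono)
      then have "2 * pm_star ?v B \<le> (norm B)\<^sup>2"
        by (simp add: pm_star_def power_mult_distrib algebra_simps)
      moreover have "(norm B)\<^sup>2 \<ge> 0" by simp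
      ultimately show ?thesis by linarith
    qed
    moreover have "E \<le> y / \<Gamma>"
      using yE \<Gamma> by (simp add: field_simps)
    ultimately show ?thesis
      unfolding H_def by (simp add: algebra_simps)
  qed
  have "continuous_on {x..y} H"
  proof -
    have "continuous_on {x..y} (velocity m B)"
      by (rule continuous_on_subset[OF continuous_on_velocity]) (use x in auto)
    then show ?thesis
      unfolding H_def p_def s_def pm_star_def by (intro continuous_intros) auto
  qed
  then obtain z where z: "x \<le> z" "H z = E"
    using IVT'[of H x E y] low high yx by blast
  have "z \<noteq> x"
    using z \<open>x\<^sup>2 * (H x - E) < 0\<close> by auto
  then have zx: "z > x" using z by simp
  define v where "v = velocity m B z"
  define \<rho> where "\<rho> = D * sqrt (s z)"
  have v: "norm v < 1" and sz: "s z > 0" and z0: "z > 0"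
    using v_lt[OF z(1)] s_pos[OF z(1)] zx x by (simp_all add: v_def)
  have sv: "s z = 1 - (norm v)\<^sup>2"
    by (simp add: s_def v_def)
  have \<rho>: "\<rho> > 0"
    using D sz by (simp add: \<rho>_def)
  have "\<Gamma> / (\<Gamma> - 1) * p z = z * s z - \<rho>"
    unfolding p_def \<rho>_def using \<Gamma> by (simp add: field_simps)
  then have "\<rho> * enthalpy \<Gamma> \<rho> (p z) = z * s z"
    using enthalpy_density[OF \<rho> \<Gamma>, of "p z"] by simp
  then have w: "\<rho> * enthalpy \<Gamma> \<rho> (p z) * (lorentz v)\<^sup>2 = z"
    using lorentz_power2[OF v] sz sv by simp
  have "\<rho> * lorentz v = D"
    using sz by (simp add: \<rho>_def lorentz_def sv)
  moreover have "z *\<^sub>R v + (norm B)\<^sup>2 *\<^sub>R v - (v \<bullet> B) *\<^sub>R B = m"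
    unfolding v_def by (rule velocity_momentum[OF z0])
  moreover have "z - total_pressure v B (p z) + (norm B)\<^sup>2 = E"
    using z(2) mag_pressure_eq_pm_star[OF v, of B]
    by (simp add: total_pressure_def H_def v_def)
  ultimately have "(D, m, B, E) = conservative \<Gamma> \<rho> v B (p z)"
    by (simp add: conservative_def w)
  then show ?thesis
    unfolding admissible_def using \<rho> p_pos[OF zx] v by blast
qed

text \<open>
  The reversed Cauchy-Schwarz inequality for the timelike vectors \<open>(1, u)\<close> and \<open>(1, v)\<close> of Minkowski
  space.
\<close>

lemma lorentz_inner_lower:
  fixes u v :: vec3
  assumes "norm u < 1" "norm v < 1"
  shows "sqrt (1 - (norm u)\<^sup>2) * sqrt (1 - (norm v)\<^sup>2) \<le> 1 - u \<bullet> v"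
proof -
  have "u \<bullet> v \<le> norm u * norm v"
    by (rule norm_cauchy_schwarz)
  moreover have "norm u * norm v \<le> 1"
    using assms by (simp add: mult_le_one)
  moreover have "(1 - (norm u)\<^sup>2) * (1 - (norm v)\<^sup>2) \<le> (1 - norm u * norm v)\<^sup>2"
    using zero_le_power2[of "norm u - norm v"] by (simp add: power2_eq_square algebra_simps)
  then have "sqrt ((1 - (norm u)\<^sup>2) * (1 - (norm v)\<^sup>2)) \<le> \<bar>1 - norm u * norm v\<bar>"
    by (metis real_sqrt_abs real_sqrt_le_iff)
  ultimately show ?thesis
    by (simp add: real_sqrt_mult)
qed

text \<open>
  With \<open>t = 1 - u \<bullet> v\<close> and \<open>s = 1 - |u|^2\<close> the constraint for the test velocity \<open>v\<close> and the test
  field \<open>B\<close> is a sum of three terms. The rest mass term is nonnegative by \<open>lorentz_inner_lower\<close>. The pressure term is \<open>p (\<Gamma> / (\<Gamma> - 1) * t / s - 1)\<close>, positive because \<open>\<Gamma> / (\<Gamma> - 1) \<ge> 2\<close> and \<open>t / s > 1 / 2\<close>. The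
  magnetic term is half of \<open>|u - v|^2 |B|^2 - ((u - v) \<bullet> B)^2\<close>.
\<close>

lemma admissible_imp_admissible1:
  assumes \<Gamma>: "1 < \<Gamma>" "\<Gamma> \<le> 2" and U: "U \<in> admissible \<Gamma>"
  shows "U \<in> admissible1"
proof -
  obtain \<rho> u B p where U_eq: "U = conservative \<Gamma> \<rho> u B p"
    and \<rho>: "\<rho> > 0" and p: "p > 0" and u: "norm u < 1"
    using U unfolding admissible_def by blast
  define s where "s = 1 - (norm u)\<^sup>2"
  have s: "s > 0"
    using u by (simp add: s_def abs_square_less_1)
  define x where "x = \<rho> * enthalpy \<Gamma> \<rho> p * (lorentz u)\<^sup>2"
  define D where "D = \<rho> * lorentz u"
  define m where "m = x *\<^sub>R u + (norm B)\<^sup>2 *\<^sub>R u - (u \<bullet> B) *\<^sub>R B"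
  define E where "E = x - (p + pm_star u B) + (norm B)\<^sup>2"
  have U': "U = (D, m, B, E)"
    by (simp add: U_eq conservative_def D_def m_def E_def x_def total_pressure_def
        mag_pressure_eq_pm_star[OF u])
  have D_eq: "D = \<rho> / sqrt s"
    by (simp add: D_def lorentz_def s_def)
  have xs: "x = (\<rho> + \<Gamma> / (\<Gamma> - 1) * p) / s"
    using enthalpy_density[OF \<rho> \<Gamma>(1)] lorentz_power2[OF u] by (simp add: x_def s_def)
  have "D * sqrt (1 - (norm v)\<^sup>2) + m \<bullet> v + pm_star v B < E" if v: "norm v < 1" for v
  proof -
    define t where "t = 1 - u \<bullet> v"
    have t_ge: "sqrt s * sqrt (1 - (norm v)\<^sup>2) \<le> t"
      unfolding s_def t_def by (rule lorentz_inner_lower[OF u v])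
    have t_half: "s < 2 * t"
    proof -
      have "u \<bullet> v \<le> norm u * norm v" by (rule norm_cauchy_schwarz)
      also have "\<dots> \<le> norm u"
        using v by (simp add: mult_left_le)
      finally have t: "1 - norm u \<le> t" by (simp add: t_def)
      have "s = (1 - norm u) * (1 + norm u)"
        by (simp add: s_def power2_eq_square algebra_simps)
      also have "\<dots> < (1 - norm u) * 2"
        using u by (intro mult_strict_left_mono) auto
      also have "\<dots> \<le> 2 * t"
        using t by simp
      finally show ?thesis .
    qed
    have "D * sqrt (1 - (norm v)\<^sup>2) = \<rho> * (sqrt s * sqrt (1 - (norm v)\<^sup>2)) / s"
      using s by (simp add: D_eq field_simps)
    also have "\<dots> \<le> \<rho> * t / s"
      using t_ge \<rho> s by (intro divide_right_mono mult_left_mono) auto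
    finally have gas: "D * sqrt (1 - (norm v)\<^sup>2) \<le> \<rho> * t / s" .
    have "p * s < p * (2 * t)"
      using t_half p by (intro mult_strict_left_mono)
    also have "\<dots> \<le> \<Gamma> / (\<Gamma> - 1) * p * t"
    proof -
      have "2 \<le> \<Gamma> / (\<Gamma> - 1)"
        using \<Gamma> by (simp add: field_simps)
      then have "2 * (p * t) \<le> \<Gamma> / (\<Gamma> - 1) * (p * t)"
        using p s t_half by (intro mult_right_mono) auto
      then show ?thesis by (simp add: mult.assoc mult.left_commute)
    qed
    finally have "p < \<Gamma> / (\<Gamma> - 1) * p * t / s"
      by (simp only: pos_less_divide_eq[OF s])
    moreover have "x * t = \<rho> * t / s + \<Gamma> / (\<Gamma> - 1) * p * t / s"
      by (simp add: xs add_divide_distrib distrib_right)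
    ultimately have hydro: "D * sqrt (1 - (norm v)\<^sup>2) + p < x * t"
      using gas by linarith
    have magnetic: "(norm B)\<^sup>2 * t + (u \<bullet> B) * (v \<bullet> B) - pm_star u B - pm_star v B \<ge> 0"
    proof -
      have "\<bar>(u - v) \<bullet> B\<bar> \<le> norm (u - v) * norm B"
        by (rule Cauchy_Schwarz_ineq2)
      then have "((u - v) \<bullet> B)\<^sup>2 \<le> (norm (u - v))\<^sup>2 * (norm B)\<^sup>2"
        by (metis abs_ge_zero power2_abs power_mono power_mult_distrib)
      moreover have "(norm B)\<^sup>2 * t + (u \<bullet> B) * (v \<bullet> B) - pm_star u B - pm_star v B
          = ((norm (u - v))\<^sup>2 * (norm B)\<^sup>2 - ((u - v) \<bullet> B)\<^sup>2) / 2"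
        unfolding t_def pm_star_def power2_norm_eq_inner[of u] power2_norm_eq_inner[of v]
          power2_norm_eq_inner[of "u - v"]
        by (simp add: inner_diff_left inner_diff_right inner_commute power2_eq_square
            algebra_simps add_divide_distrib diff_divide_distrib)
      ultimately show ?thesis by simp
    qed
    have "m \<bullet> v = (x + (norm B)\<^sup>2) * (1 - t) - (u \<bullet> B) * (v \<bullet> B)"
      by (simp add: m_def t_def inner_diff_left inner_add_left inner_commute algebra_simps)
    then show ?thesis
      using hydro magnetic unfolding E_def by (simp add: algebra_simps)
  qed
  moreover have "D > 0"
    using \<rho> s by (simp add: D_eq)
  ultimately show ?thesis
    unfolding U' by (simp add: admissible1_iff)
qed

theorem theorem2p3:
  fixes \<Gamma> :: real
  assumes "1 < \<Gamma>" and "\<Gamma> \<le> 2"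
  shows "admissible \<Gamma> = admissible1 \<and> admissible0 = admissible1"
proof -
  have "(U \<in> admissible \<Gamma> \<longleftrightarrow> U \<in> admissible1) \<and> (U \<in> admissible0 \<longleftrightarrow> U \<in> admissible1)" for U
  proof (cases "fst U > 0")
    case True
    obtain D m B E where U: "U = (D, m, B, E)"
      by (cases U) auto
    have D: "D > 0" using True U by simp
    obtain x where x: "x > 0" and root:
      "cold_residual ((norm B)\<^sup>2) (D\<^sup>2 + (norm m)\<^sup>2) (mag_invariant D m B) x = 0"
      using cold_root_exists[OF D] by blast
    show ?thesis
      using admissible_imp_admissible1[OF assms, of U] admissible1_imp_cold[OF _ x root, of E]
        cold_imp_admissible[OF assms(1) D x root, of E] admissible0_iff_cold[OF x root, of E] D
      unfolding U by blast
  next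
    case False
    then show ?thesis
      using admissible_imp_admissible1[OF assms, of U]
      by (auto simp: admissible0_def admissible1_def)
  qed
  then show ?thesis by blast
qed

end
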